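(* Let $(X,\omega,\mu)$ be an infinite, connected weighted graph, and let $d$ be a pseudo metric on $X$ satisfying property (PM). Let $f:[0,\infty)\to[0,\infty)$ be a locally Lipschitz, convex function with $f(0)=0$, $f(u)>0$ for all $u>0$, $\int_1^\infty \frac{du}{f(u)}<\infty$ and $\lim_{u\to\infty}\frac{f(u)}{u}=+\infty$. Let $u_0:X\to[0,+\infty)$ be bounded with $u_0\not\equiv 0$, and let $u$ be a solution of the Cauchy problem $u_t-\Delta u=f(u)$ in $X\times(0,T)$, $u=u_0$ in $X\times\{0\}$, with maximal time of existence $T\in(0,+\infty]$. Assume that $\varphi:X\to\mathbb{R}$ satisfies property ($\mathcal{B}_G$), let $\lambda>0$ be the constant appearing in part (d) of that property, and assume that $$\varphi\,\sup_{t\in(t_0,T')}|u_t(\cdot,t)|\in\ell^1(X,\mu)\qquad\text{for all } t_0,T' \text{ such that } 0<t_0<T'<T.$$ If $$\sum_{x\in X}u_0(x)\,\varphi(x)\,\mu(x)>s_0(\lambda),\qquad\text{where } s_0(\lambda):=\inf\Bigl\{v>0:\ \frac{f(v)}{v}>\lambda\Bigr\},$$ then $u$ blows up in finite time.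
   Context: Weighted graph: $X$ is a countably infinite set, $\mu:X\to(0,+\infty)$ (node measure), and $\omega:X\times X\to[0,+\infty)$ (edge weight) satisfies $\omega(x,x)=0$, $\omega(x,y)=\omega(y,x)$ and $\sum_{y\in X}\omega(x,y)<+\infty$ for all $x,y\in X$. One writes $x\sim y$ if $\omega(x,y)>0$. The graph is connected if any two vertices are joined by a finite path of consecutively adjacent vertices. $\ell^1(X,\mu)$ is the set of $g:X\to\mathbb{R}$ with $\|g\|_1:=\sum_{x\in X}|g(x)|\mu(x)<+\infty$; $\ell^\infty(X)$ is the set of bounded functions on $X$, with the sup norm $\|\cdot\|_\infty$. Difference operator: $\nabla_{xy}g:=g(y)-g(x)$. Laplacian: $\Delta g(x):=\frac{1}{\mu(x)}\sum_{y\in X}\omega(x,y)[g(y)-g(x)]$ (well defined for all $g:X\to\mathbb{R}$ here, since property (PM) below forces each vertex to have finitely many neighbors); it acts on the space variable of $u(x,t)$. A pseudo metric is a function $d:X\times X\to[0,+\infty)$ with $d(x,x)=0$, $d(x,y)=d(y,x)$ and $d(x,y)\le d(x,z)+d(z,y)$. Its jump size is $s:=\sup\{d(x,y):x\sim y\}$. For a vertex $x_0$ and $r>0$, $B_r(x_0):=\{x:d(x,x_0)<r\}$ and $\overline{B}_r(x_0):=\{x:d(x,x_0)\le r\}$; $B_r(x_0)=\emptyset$ for $r\le0$. Property (PM): (a) $0<s<+\infty$; (b) $B_r(x)$ is a finite set for every $x\in X$, $r>0$; (c) there is $C_0>0$ with $\frac{1}{\mu(x)}\sum_{y\in X}\omega(x,y)d(x,y)\le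 C_0$ for all $x\in X$. A reference vertex $x_0\in X$ is fixed and $B_r:=B_r(x_0)$, $\overline{B}_r:=\overline{B}_r(x_0)$. Property ($\mathcal{B}_G$) for $\varphi:X\to\mathbb{R}$: (a) $\varphi(x)>0$ for all $x\in X$; (b) $\|\varphi\|_1=\sum_{x\in X}\varphi(x)\mu(x)=1$; (c) there is a constant $C_1>0$ such that $\sum_{x,y\in X,\ x\in\overline{B}_R\setminus B_{(1-\delta)R-2s}}\omega(x,y)|\nabla_{xy}\varphi|\le C_1$ for all $R>0$, $\delta\in(0,1)$; (d) there is a constant $\lambda>0$ such that $\Delta\varphi(x)+\lambda\varphi(x)\ge0$ for all $x\in X$. Solution: a function $u:X\times[0,T)\to\mathbb{R}$ with $u(x,\cdot)\in C^1((0,T))\cap C^0([0,T))$ for all $x\in X$, $u\in L^\infty(X\times[0,T'])$ for all $T'\in(0,T)$, $u\ge0$ in $X\times(0,T)$, and satisfying the equation and the initial condition pointwise. The solution is considered up to its maximal time of existence $T\in(0,+\infty]$, and by convention exactly one of two alternatives holds: either $T=+\infty$ and $u(\cdot,t)\in\ell^\infty(X)$ for all $t>0$ ($u$ is global), or $T<+\infty$ and $\lim_{t\to T^-}\|u(\cdot,t)\|_\infty=+\infty$. "$u$ blows up in finite time" means that the maximal time of existence is finite, $0<T<+\infty$, with $u(\cdot,t)\in\ell^\infty(X)$ for all $t\in(0,T)$ and $\lim_{t\to T^-}\|u(\cdot,t)\|_\infty=+\infty$. *)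

theory Defs
  imports "HOL-Analysis.Analysis"
begin

text \<open>
  The vertex set \<open>X\<close> is the universe of a type \<open>'a\<close>. Sums over \<open>X\<close> are unordered infinite sums;
  since \<open>infsum\<close> is \<open>0\<close> for non-summable families, summability is stated separately wherever the
  finiteness of a sum is part of a hypothesis.
\<close>

definition weighted_graph :: "('a \<Rightarrow> real) \<Rightarrow> ('a \<Rightarrow> 'a \<Rightarrow> real) \<Rightarrow> bool" where
  "weighted_graph \<mu> \<omega> \<longleftrightarrow>
     countable (UNIV :: 'a set) \<and> infinite (UNIV :: 'a set) \<and>
     (\<forall>x. 0 < \<mu> x) \<and>
     (\<forall>x y. 0 \<le> \<omega> x y) \<and> (\<forall>x. \<omega> x x = 0) \<and> (\<forall>x y. \<omega> x y = \<omega> y x) \<and>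
     (\<forall>x. (\<lambda>y. \<omega> x y) summable_on UNIV)"

definition adjacent :: "('a \<Rightarrow> 'a \<Rightarrow> real) \<Rightarrow> 'a \<Rightarrow> 'a \<Rightarrow> bool" where
  "adjacent \<omega> x y \<longleftrightarrow> 0 < \<omega> x y"

definition connected_graph :: "('a \<Rightarrow> 'a \<Rightarrow> real) \<Rightarrow> bool" where
  "connected_graph \<omega> \<longleftrightarrow> (\<forall>x y. (adjacent \<omega>)\<^sup>*\<^sup>* x y)"

definition laplacian :: "('a \<Rightarrow> real) \<Rightarrow> ('a \<Rightarrow> 'a \<Rightarrow> real) \<Rightarrow> ('a \<Rightarrow> real) \<Rightarrow> 'a \<Rightarrow> real" where
  "laplacian \<mu> \<omega> g x = 1 / \<mu> x * (\<Sum>\<^sub>\<infinity>y. \<omega> x y * (g y - g x))"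

definition in_ell_1 :: "('a \<Rightarrow> real) \<Rightarrow> ('a \<Rightarrow> real) \<Rightarrow> bool" where
  "in_ell_1 \<mu> g \<longleftrightarrow> (\<lambda>x. \<bar>g x\<bar> * \<mu> x) summable_on UNIV"

definition in_ell_inf :: "('a \<Rightarrow> real) \<Rightarrow> bool" where
  "in_ell_inf g \<longleftrightarrow> bounded (range g)"

text \<open>Only meaningful for bounded \<open>g\<close>.\<close>

definition sup_norm :: "('a \<Rightarrow> real) \<Rightarrow> real" where
  "sup_norm g = (SUP x. \<bar>g x\<bar>)"

definition pseudo_metric :: "('a \<Rightarrow> 'a \<Rightarrow> real) \<Rightarrow> bool" where
  "pseudo_metric d \<longleftrightarrow>
     (\<forall>x y. 0 \<le> d x y) \<and> (\<forall>x. d x x = 0) \<and> (\<forall>x y. d x y = d y x) \<and>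
     (\<forall>x y z. d x y \<le> d x z + d z y)"

definition jump_size :: "('a \<Rightarrow> 'a \<Rightarrow> real) \<Rightarrow> ('a \<Rightarrow> 'a \<Rightarrow> real) \<Rightarrow> ereal" where
  "jump_size \<omega> d = Sup {ereal (d x y) | x y. adjacent \<omega> x y}"

definition pm_ball :: "('a \<Rightarrow> 'a \<Rightarrow> real) \<Rightarrow> 'a \<Rightarrow> real \<Rightarrow> 'a set" where
  "pm_ball d x0 r = {x. d x x0 < r}"

definition pm_cball :: "('a \<Rightarrow> 'a \<Rightarrow> real) \<Rightarrow> 'a \<Rightarrow> real \<Rightarrow> 'a set" where
  "pm_cball d x0 r = {x. d x x0 \<le> r}"

definition property_PM ::
  "('a \<Rightarrow> real) \<Rightarrow> ('a \<Rightarrow> 'a \<Rightarrow> real) \<Rightarrow> ('a \<Rightarrow> 'a \<Rightarrow> real) \<Rightarrow> bool" where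
  "property_PM \<mu> \<omega> d \<longleftrightarrow>
     (0 < jump_size \<omega> d \<and> jump_size \<omega> d < \<infinity>) \<and>
     (\<forall>x. \<forall>r>0. finite (pm_ball d x r)) \<and>
     (\<exists>C\<^sub>0>0. \<forall>x. (\<lambda>y. \<omega> x y * d x y) summable_on UNIV \<and>
        1 / \<mu> x * (\<Sum>\<^sub>\<infinity>y. \<omega> x y * d x y) \<le> C\<^sub>0)"

text \<open>
  The last argument is the constant \<open>\<lambda>\<close> of the differential inequality. In the third conjunct, the
  double sum is taken over all pairs \<open>(x, y)\<close> whose first component lies in the annulus.
\<close>

definition property_BG ::
  "('a \<Rightarrow> real) \<Rightarrow> ('a \<Rightarrow> 'a \<Rightarrow> real) \<Rightarrow> ('a \<Rightarrow> 'a \<Rightarrow> real) \<Rightarrow> 'a \<Rightarrow> ('a \<Rightarrow> real) \<Rightarrow> real \<Rightarrow> bool" where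
  "property_BG \<mu> \<omega> d x0 \<phi> lam \<longleftrightarrow>
     (\<forall>x. 0 < \<phi> x) \<and>
     ((\<lambda>x. \<phi> x * \<mu> x) has_sum 1) UNIV \<and>
     (\<exists>C\<^sub>1>0. \<forall>R>0. \<forall>\<delta>. 0 < \<delta> \<and> \<delta> < 1 \<longrightarrow>
        (let s = real_of_ereal (jump_size \<omega> d);
             A = pm_cball d x0 R - pm_ball d x0 ((1 - \<delta>) * R - 2 * s)
         in (\<lambda>(x, y). \<omega> x y * \<bar>\<phi> y - \<phi> x\<bar>) summable_on (A \<times> UNIV) \<and>
            (\<Sum>\<^sub>\<infinity>(x, y)\<in>A \<times> UNIV. \<omega> x y * \<bar>\<phi> y - \<phi> x\<bar>) \<le> C\<^sub>1)) \<and>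
     0 < lam \<and> (\<forall>x. laplacian \<mu> \<omega> \<phi> x + lam * \<phi> x \<ge> 0)"

definition locally_lipschitz_on :: "real set \<Rightarrow> (real \<Rightarrow> real) \<Rightarrow> bool" where
  "locally_lipschitz_on S f \<longleftrightarrow>
     (\<forall>x\<in>S. \<exists>e>0. \<exists>L. L-lipschitz_on (cball x e \<inter> S) f)"

text \<open>
  A solution on \<open>X \<times> [0, T)\<close> is given by a function \<open>u\<close> whose values at times outside \<open>[0, T)\<close> are
  irrelevant. By continuity in time, essential boundedness on \<open>X \<times> [0, T']\<close> is boundedness.
\<close>

definition solution ::
  "('a \<Rightarrow> real) \<Rightarrow> ('a \<Rightarrow> 'a \<Rightarrow> real) \<Rightarrow> (real \<Rightarrow> real) \<Rightarrow> ('a \<Rightarrow> real) \<Rightarrow> ('a \<Rightarrow> real \<Rightarrow> real) \<Rightarrow> ereal \<Rightarrow> bool"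
where
  "solution \<mu> \<omega> f u0 u T \<longleftrightarrow>
     0 < T \<and>
     (\<forall>x. u x C1_differentiable_on {t. 0 < t \<and> ereal t < T}) \<and>
     (\<forall>x. continuous_on {t. 0 \<le> t \<and> ereal t < T} (u x)) \<and>
     (\<forall>T'. 0 < T' \<and> ereal T' < T \<longrightarrow> bounded ((\<lambda>(x, t). u x t) ` (UNIV \<times> {0..T'}))) \<and>
     (\<forall>x t. 0 < t \<and> ereal t < T \<longrightarrow> 0 \<le> u x t) \<and>
     (\<forall>x t. 0 < t \<and> ereal t < T \<longrightarrow>
        deriv (u x) t - laplacian \<mu> \<omega> (\<lambda>y. u y t) x = f (u x t)) \<and>
     (\<forall>x. u x 0 = u0 x)"

definition global_in_time :: "('a \<Rightarrow> real \<Rightarrow> real) \<Rightarrow> ereal \<Rightarrow> bool" where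
  "global_in_time u T \<longleftrightarrow> T = \<infinity> \<and> (\<forall>t>0. in_ell_inf (\<lambda>x. u x t))"

definition sup_norm_diverges :: "('a \<Rightarrow> real \<Rightarrow> real) \<Rightarrow> ereal \<Rightarrow> bool" where
  "sup_norm_diverges u T \<longleftrightarrow>
     filterlim (\<lambda>t. sup_norm (\<lambda>x. u x t)) at_top (at_left (real_of_ereal T))"

text \<open>
  The convention that \<open>T\<close> is the maximal time of existence of \<open>u\<close>. In the second alternative \<open>u\<close>
  cannot be continued beyond \<open>T\<close>, because solutions are bounded on compact time intervals.
\<close>

definition maximal_solution ::
  "('a \<Rightarrow> real) \<Rightarrow> ('a \<Rightarrow> 'a \<Rightarrow> real) \<Rightarrow> (real \<Rightarrow> real) \<Rightarrow> ('a \<Rightarrow> real) \<Rightarrow> ('a \<Rightarrow> real \<Rightarrow> real) \<Rightarrow> ereal \<Rightarrow> bool"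
where
  "maximal_solution \<mu> \<omega> f u0 u T \<longleftrightarrow>
     solution \<mu> \<omega> f u0 u T \<and>
     (global_in_time u T \<or> (T < \<infinity> \<and> sup_norm_diverges u T))"

definition blows_up_in_finite_time :: "('a \<Rightarrow> real \<Rightarrow> real) \<Rightarrow> ereal \<Rightarrow> bool" where
  "blows_up_in_finite_time u T \<longleftrightarrow>
     0 < T \<and> T < \<infinity> \<and>
     (\<forall>t. 0 < t \<and> ereal t < T \<longrightarrow> in_ell_inf (\<lambda>x. u x t)) \<and>
     sup_norm_diverges u T"

definition s_0 :: "(real \<Rightarrow> real) \<Rightarrow> real \<Rightarrow> real" where
  "s_0 f lam = Inf {v. 0 < v \<and> f v / v > lam}"

end

theory Submission
  imports Defs
begin

text \<open>
  By maximality it is enough to rule out \<open>T = \<infinity>\<close>. The argument is Kaplan's: test the equation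
  with \<open>\<phi>\<close>. For the weighted mean \<open>F(t) = \<Sum>x. u(x,t) \<phi>(x) \<mu>(x)\<close>, Green's formula and
  \<open>\<Delta>\<phi> + \<lambda>\<phi> \<ge> 0\<close> bound the diffusion from below by \<open>- \<lambda> F\<close>, and Jensen's inequality bounds the
  reaction from below by \<open>f(F)\<close>. Formally \<open>F' \<ge> f(F) - \<lambda> F\<close>, the right side is at least a positive
  multiple of \<open>f(F)\<close> once \<open>F\<close> exceeds \<open>s\<^sub>0(\<lambda>)\<close>, and \<open>1 / f\<close> is integrable at infinity, so \<open>F\<close>
  cannot exist for arbitrarily long times.

  Interchanging the infinite sum with \<open>d/dt\<close> and with \<open>\<Delta>\<close> is avoided by inserting the cutoff
  \<open>\<eta>\<^sub>R(x) = max 0 (1 - d(x,x\<^sub>0)/R)\<close>. Its support lies in a finite ball, so the mean becomes a finite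
  sum. Two things have to be paid for. Since \<open>\<eta>\<^sub>R\<close> is \<open>1/R\<close>-Lipschitz for \<open>d\<close> and
  \<open>\<Sum>y. \<omega>(x,y) d(x,y) \<le> C\<^sub>0 \<mu>(x)\<close>, Green's formula acquires an error of at most \<open>M C\<^sub>0 / R\<close>,
  where \<open>M\<close> bounds \<open>u\<close> on the time interval considered (\<open>cutoff_laplacian_lower_bound\<close>). And the
  weights \<open>\<eta>\<^sub>R \<phi> \<mu>\<close> have total mass at most one instead of equal to one, which Jensen's
  inequality tolerates because \<open>f 0 = 0\<close> (\<open>jensen_subprobability\<close>).

  The order of the choices matters: the length \<open>\<tau>\<close> of the time interval is fixed first, longer
  than the lifespan that \<open>osgood_time_bound\<close> allows; this determines \<open>M\<close>; then \<open>R\<close> is chosen so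
  large that the error is absorbed by half of the reaction term and the initial mean with cutoff
  still exceeds \<open>s\<^sub>0(\<lambda>)\<close> (\<open>cutoff_mass_eventually_gt\<close>).
\<close>

section \<open>Finite summation by parts\<close>

text \<open>All neighbours of \<open>x\<close> lie in a ball around \<open>x\<close> whose radius exceeds the jump size.\<close>

lemma finite_neighbours:
  assumes "weighted_graph \<mu> \<omega>" and "pseudo_metric d" and "property_PM \<mu> \<omega> d"
  shows "finite {y. \<omega> x y \<noteq> 0}"
proof -
  have pos: "0 < jump_size \<omega> d" and fin: "jump_size \<omega> d < \<infinity>"
    and balls: "\<forall>x. \<forall>r>0. finite (pm_ball d x r)"
    using assms(3) by (auto simp: property_PM_def)
  define s where "s = real_of_ereal (jump_size \<omega> d)"
  have s: "jump_size \<omega> d = ereal s"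
    using pos fin unfolding s_def by (cases "jump_size \<omega> d") auto
  have "{y. \<omega> x y \<noteq> 0} \<subseteq> pm_ball d x (s + 1)"
  proof
    fix y assume "y \<in> {y. \<omega> x y \<noteq> 0}"
    then have "adjacent \<omega> x y"
      using assms(1) by (auto simp: weighted_graph_def adjacent_def order_less_le)
    then have "ereal (d x y) \<le> jump_size \<omega> d"
      unfolding jump_size_def by (intro Sup_upper) auto
    then show "y \<in> pm_ball d x (s + 1)"
      using assms(2) s by (auto simp: pm_ball_def pseudo_metric_def)
  qed
  moreover have "0 < s + 1" using pos s by simp
  ultimately show ?thesis using balls finite_subset by blast
qed

lemma laplacian_eq_finite_sum:
  assumes "finite N" and "{y. \<omega> x y \<noteq> 0} \<subseteq> N" and "0 < \<mu> x"
  shows "\<mu> x * laplacian \<mu> \<omega> g x = (\<Sum>y\<in>N. \<omega> x y * (g y - g x))"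
proof -
  have "(\<Sum>\<^sub>\<infinity>y. \<omega> x y * (g y - g x)) = (\<Sum>\<^sub>\<infinity>y\<in>N. \<omega> x y * (g y - g x))"
    using assms(2) by (intro infsum_cong_neutral) auto
  then show ?thesis using assms by (simp add: laplacian_def)
qed

lemma symmetric_kernel_summation_by_parts:
  fixes \<omega> :: "'a \<Rightarrow> 'a \<Rightarrow> real" and p v :: "'a \<Rightarrow> real"
  assumes "\<And>x y. \<omega> x y = \<omega> y x"
  shows "(\<Sum>x\<in>N. p x * (\<Sum>y\<in>N. \<omega> x y * (v y - v x)))
       = (\<Sum>x\<in>N. v x * (\<Sum>y\<in>N. \<omega> x y * (p y - p x)))"
proof -
  have "(\<Sum>x\<in>N. \<Sum>y\<in>N. \<omega> x y * (p x * v y)) = (\<Sum>x\<in>N. \<Sum>y\<in>N. \<omega> x y * (p y * v x))"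
    by (subst sum.swap) (simp add: assms)
  then show ?thesis
    by (simp add: sum_distrib_left right_diff_distrib sum_subtractf mult_ac)
qed

definition cutoff :: "('a \<Rightarrow> 'a \<Rightarrow> real) \<Rightarrow> 'a \<Rightarrow> real \<Rightarrow> 'a \<Rightarrow> real" where
  "cutoff d x0 R x = max 0 (1 - d x x0 / R)"

lemma cutoff_nonneg: "0 \<le> cutoff d x0 R x"
  by (simp add: cutoff_def)

lemma cutoff_le_1: "pseudo_metric d \<Longrightarrow> 0 < R \<Longrightarrow> cutoff d x0 R x \<le> 1"
  by (simp add: cutoff_def pseudo_metric_def)

lemma cutoff_outside: "0 < R \<Longrightarrow> x \<notin> pm_ball d x0 R \<Longrightarrow> cutoff d x0 R x = 0"
  by (simp add: cutoff_def pm_ball_def field_simps)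

lemma cutoff_lipschitz:
  assumes "pseudo_metric d" and "0 < R"
  shows "\<bar>cutoff d x0 R y - cutoff d x0 R x\<bar> \<le> d x y / R"
proof -
  have "d x x0 \<le> d x y + d y x0" "d y x0 \<le> d y x + d x x0" "d x y = d y x"
    using assms(1) unfolding pseudo_metric_def by blast+
  then have "\<bar>d x x0 - d y x0\<bar> \<le> d x y" by linarith
  then have "\<bar>(1 - d y x0 / R) - (1 - d x x0 / R)\<bar> \<le> d x y / R"
    using assms(2) by (simp add: diff_divide_distrib[symmetric] divide_right_mono)
  then show ?thesis unfolding cutoff_def by linarith
qed

lemma cutoff_tendsto_1: "((\<lambda>R. cutoff d x0 R x) \<longlongrightarrow> 1) at_top"
proof -
  have "((\<lambda>R. max 0 (1 - d x x0 / R)) \<longlongrightarrow> max 0 (1 - 0)) at_top"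
    by (intro tendsto_intros tendsto_divide_0[OF tendsto_const]
        filterlim_at_top_imp_at_infinity filterlim_ident)
  then show ?thesis unfolding cutoff_def by simp
qed

text \<open>
  A cutoff version of \<open>\<Sum>x. \<phi> (\<Delta>v) \<mu> \<ge> - \<lambda> \<Sum>x. \<phi> v \<mu>\<close>. After summation by parts the Laplacian falls
  on the product of the cutoff \<open>h\<close> and \<open>\<phi>\<close>. The discrete product rule
  \<open>h y * \<phi> y - h x * \<phi> x = h x * (\<phi> y - \<phi> x) + \<phi> y * (h y - h x)\<close> separates a term controlled by
  the differential inequality for \<open>\<phi>\<close> from a term containing only differences of \<open>h\<close>. The latter
  carries the factor \<open>\<phi> y\<close> and not \<open>\<phi> x\<close>; summing over \<open>x\<close> first therefore bounds it
  by \<open>M / R\<close> times \<open>\<Sum>y. \<phi> y * C\<^sub>0 * \<mu> y \<le> C\<^sub>0\<close>.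
\<close>

lemma cutoff_laplacian_lower_bound:
  fixes \<mu> \<phi> v :: "'a \<Rightarrow> real" and \<omega> d :: "'a \<Rightarrow> 'a \<Rightarrow> real" and x0 :: 'a
  assumes graph: "weighted_graph \<mu> \<omega>" and metric: "pseudo_metric d"
    and PM: "property_PM \<mu> \<omega> d"
    and C0: "\<And>x. (\<lambda>y. \<omega> x y * d x y) summable_on UNIV"
      "\<And>x. 1 / \<mu> x * (\<Sum>\<^sub>\<infinity>y. \<omega> x y * d x y) \<le> C\<^sub>0"
    and phi_pos: "\<And>x. 0 < \<phi> x" and phi_sum: "((\<lambda>x. \<phi> x * \<mu> x) has_sum 1) UNIV"
    and super: "\<And>x. 0 \<le> laplacian \<mu> \<omega> \<phi> x + lam * \<phi> x"
    and v: "\<And>x. 0 \<le> v x" "\<And>x. v x \<le> M" and R: "0 < R"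
  defines "w \<equiv> (\<lambda>x. cutoff d x0 R x * \<phi> x * \<mu> x)"
  shows "- lam * (\<Sum>x\<in>pm_ball d x0 R. w x * v x) - M * C\<^sub>0 / R
           \<le> (\<Sum>x\<in>pm_ball d x0 R. w x * laplacian \<mu> \<omega> v x)"
proof -
  define B where "B = pm_ball d x0 R"
  define h where "h = cutoff d x0 R"
  \<comment> \<open>Finite, and containing the ball with all its neighbours: sums over the ball and over
    neighbours both extend to \<open>N\<close>, where they can be interchanged.\<close>
  define N where "N = B \<union> (\<Union>x\<in>B. {y. \<omega> x y \<noteq> 0})"
  have mu: "\<And>x. 0 < \<mu> x" and om: "\<And>x y. 0 \<le> \<omega> x y" and sym: "\<And>x y. \<omega> x y = \<omega> y x"
    using graph by (auto simp: weighted_graph_def)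
  have d: "\<And>x y. 0 \<le> d x y" "\<And>x y. d x y = d y x"
    using metric by (auto simp: pseudo_metric_def)
  have finB: "finite B" using PM R by (auto simp: B_def property_PM_def)
  have finN: "finite N"
    unfolding N_def using finB finite_neighbours[OF graph metric PM] by auto
  have BN: "B \<subseteq> N" by (auto simp: N_def)
  have nb: "{y. \<omega> x y \<noteq> 0} \<subseteq> N" if "x \<in> B" for x using that by (auto simp: N_def)
  have h0: "h x = 0" if "x \<notin> B" for x
    using that R by (simp add: h_def B_def cutoff_outside)
  have M: "0 \<le> M" using v[of x0] by linarith
  have lap: "(\<Sum>y\<in>N. \<omega> x y * (g y - g x)) = \<mu> x * laplacian \<mu> \<omega> g x" if "x \<in> B" for g x
    using laplacian_eq_finite_sum[of N \<omega> x \<mu> g] finN nb[OF that] mu by simp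
  have extend: "(\<Sum>x\<in>B. k x) = (\<Sum>x\<in>N. k x)" if "\<And>x. x \<notin> B \<Longrightarrow> k x = 0" for k :: "'a \<Rightarrow> real"
    using that finN BN by (intro sum.mono_neutral_left) auto
  have "(\<Sum>x\<in>B. w x * laplacian \<mu> \<omega> v x)
      = (\<Sum>x\<in>B. h x * \<phi> x * (\<Sum>y\<in>N. \<omega> x y * (v y - v x)))"
    by (intro sum.cong refl) (simp add: lap w_def h_def)
  also have "\<dots> = (\<Sum>x\<in>N. h x * \<phi> x * (\<Sum>y\<in>N. \<omega> x y * (v y - v x)))"
    by (rule extend) (simp add: h0)
  also have "\<dots> = (\<Sum>x\<in>N. v x * (\<Sum>y\<in>N. \<omega> x y * (h y * \<phi> y - h x * \<phi> x)))"
    by (rule symmetric_kernel_summation_by_parts) (rule sym)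
  also have "\<dots> = (\<Sum>x\<in>N. v x * h x * (\<Sum>y\<in>N. \<omega> x y * (\<phi> y - \<phi> x)))
                 + (\<Sum>x\<in>N. \<Sum>y\<in>N. v x * \<omega> x y * \<phi> y * (h y - h x))"
    by (simp add: sum_distrib_left sum.distrib[symmetric] algebra_simps)
  finally have split: "(\<Sum>x\<in>B. w x * laplacian \<mu> \<omega> v x) = \<dots>" .
  have "- lam * (\<Sum>x\<in>B. w x * v x) \<le> (\<Sum>x\<in>B. v x * h x * (\<mu> x * laplacian \<mu> \<omega> \<phi> x))"
  proof -
    have "- lam * (w x * v x) \<le> v x * h x * (\<mu> x * laplacian \<mu> \<omega> \<phi> x)" for x
    proof -
      have "0 \<le> (v x * h x * \<mu> x) * (laplacian \<mu> \<omega> \<phi> x + lam * \<phi> x)"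
        using v(1) mu[of x] super by (intro mult_nonneg_nonneg) (auto simp: h_def cutoff_nonneg)
      then show ?thesis by (simp add: w_def h_def algebra_simps)
    qed
    then show ?thesis by (subst sum_distrib_left) (rule sum_mono)
  qed
  also have "\<dots> = (\<Sum>x\<in>B. v x * h x * (\<Sum>y\<in>N. \<omega> x y * (\<phi> y - \<phi> x)))"
    by (intro sum.cong refl) (simp add: lap)
  also have "\<dots> = (\<Sum>x\<in>N. v x * h x * (\<Sum>y\<in>N. \<omega> x y * (\<phi> y - \<phi> x)))"
    by (rule extend) (simp add: h0)
  finally have main: "- lam * (\<Sum>x\<in>B. w x * v x) \<le> \<dots>" .
  have row: "(\<Sum>x\<in>N. \<omega> y x * d y x) \<le> C\<^sub>0 * \<mu> y" for y
  proof -
    have "(\<Sum>x\<in>N. \<omega> y x * d y x) \<le> (\<Sum>\<^sub>\<infinity>x. \<omega> y x * d y x)"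
      using finN om d by (intro finite_sum_le_infsum C0) auto
    then show ?thesis using C0(2)[of y] mu[of y] by (simp add: field_simps)
  qed
  have C0_nonneg: "0 \<le> C\<^sub>0"
    using row[of x0] mu[of x0] sum_nonneg[of N "\<lambda>x. \<omega> x0 x * d x0 x"] om d
    by (smt (verit) mult_nonneg_nonneg mult_neg_pos)
  have mass: "(\<Sum>y\<in>N. \<phi> y * \<mu> y) \<le> 1"
    using phi_pos mu finN has_sum_imp_summable[OF phi_sum] infsumI[OF phi_sum]
      finite_sum_le_infsum[of "\<lambda>x. \<phi> x * \<mu> x" UNIV N] by (simp add: less_imp_le)
  have "- (M * C\<^sub>0 / R) \<le> - (M / R * C\<^sub>0 * (\<Sum>y\<in>N. \<phi> y * \<mu> y))"
    using mult_left_mono[OF mass, of "M / R * C\<^sub>0"] M C0_nonneg R by simp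
  also have "\<dots> = - (\<Sum>y\<in>N. M / R * \<phi> y * (C\<^sub>0 * \<mu> y))"
    by (simp add: sum_distrib_left mult_ac)
  also have "\<dots> \<le> - (\<Sum>y\<in>N. M / R * \<phi> y * (\<Sum>x\<in>N. \<omega> y x * d y x))"
    using row M R phi_pos
    by (intro le_imp_neg_le sum_mono mult_left_mono) (auto simp: less_imp_le)
  also have "\<dots> = (\<Sum>y\<in>N. \<Sum>x\<in>N. - (M / R * \<phi> y * (\<omega> y x * d y x)))"
    by (simp add: sum_distrib_left sum_negf)
  also have "\<dots> = (\<Sum>x\<in>N. \<Sum>y\<in>N. - (M / R * \<phi> y * (\<omega> y x * d y x)))"
    by (rule sum.swap)
  also have "\<dots> \<le> (\<Sum>x\<in>N. \<Sum>y\<in>N. v x * \<omega> x y * \<phi> y * (h y - h x))"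
  proof (intro sum_mono)
    fix x y
    have "- (v x * \<omega> x y * \<phi> y * (h y - h x)) \<le> v x * \<omega> x y * \<phi> y * \<bar>h y - h x\<bar>"
      using v(1) om phi_pos
      by (simp add: minus_mult_right mult_left_mono less_imp_le del: mult_minus_right)
    also have "\<dots> \<le> M * \<omega> x y * \<phi> y * (d x y / R)"
      using v om phi_pos cutoff_lipschitz[OF metric R, of x0 y x] M
      by (intro mult_mono) (auto simp: h_def less_imp_le)
    finally show "- (M / R * \<phi> y * (\<omega> y x * d y x)) \<le> v x * \<omega> x y * \<phi> y * (h y - h x)"
      using sym[of x y] d(2)[of x y] by (simp add: mult_ac)
  qed
  finally have error: "- (M * C\<^sub>0 / R) \<le> \<dots>" .
  show ?thesis using split main error by (simp add: B_def)
qed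

section \<open>Convexity and superlinearity\<close>

text \<open>The missing mass is placed at the point \<open>0\<close>, where \<open>f\<close> vanishes; it is the index \<open>None\<close>.\<close>

lemma jensen_subprobability:
  fixes f :: "real \<Rightarrow> real"
  assumes "convex_on {0..} f" and "f 0 = 0" and "finite B"
    and w: "\<And>x. x \<in> B \<Longrightarrow> 0 \<le> w x" "(\<Sum>x\<in>B. w x) \<le> 1"
    and y: "\<And>x. x \<in> B \<Longrightarrow> 0 \<le> y x"
  shows "f (\<Sum>x\<in>B. w x * y x) \<le> (\<Sum>x\<in>B. w x * f (y x))"
proof -
  define W where "W = (\<Sum>x\<in>B. w x)"
  define B' where "B' = insert None (Some ` B)"
  define a where "a i = (case i of None \<Rightarrow> 1 - W | Some x \<Rightarrow> w x)" for i
  define z where "z i = (case i of None \<Rightarrow> 0 | Some x \<Rightarrow> y x)" for i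
  have s: "(\<Sum>i\<in>B'. g i) = g None + (\<Sum>x\<in>B. g (Some x))" for g :: "_ \<Rightarrow> real"
    using assms(3) by (simp add: B'_def sum.reindex)
  have "f (\<Sum>i\<in>B'. a i *\<^sub>R z i) \<le> (\<Sum>i\<in>B'. a i * f (z i))"
  proof (rule convex_on_sum[OF _ _ assms(1)])
    show "sum a B' = 1" by (simp add: s a_def W_def)
  qed (use assms in \<open>auto simp: B'_def a_def z_def W_def\<close>)
  then show ?thesis using assms(2) by (simp add: s a_def z_def)
qed

text \<open>Convexity together with \<open>f 0 = 0\<close> gives \<open>f a \<le> (a / b) * f b\<close>: Jensen for a single weight.\<close>

lemma convex_quotient_mono:
  fixes f :: "real \<Rightarrow> real"
  assumes "convex_on {0..} f" and "f 0 = 0" and "0 < a" and "a \<le> b"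
  shows "f a / a \<le> f b / b"
proof -
  have "f (\<Sum>x\<in>{b}. a / b * x) \<le> (\<Sum>x\<in>{b}. a / b * f x)"
    using assms by (intro jensen_subprobability) auto
  then show ?thesis using assms by (simp add: field_simps)
qed

text \<open>
  Since \<open>v \<mapsto> f v / v\<close> is nondecreasing, the set in the definition of \<open>s_0\<close> is an up-set in \<open>{0<..}\<close>;
  superlinear growth makes it nonempty, so that its infimum is meaningful.
\<close>

lemma above_s_0:
  fixes f :: "real \<Rightarrow> real"
  assumes "convex_on {0..} f" and "f 0 = 0"
    and "filterlim (\<lambda>v. f v / v) at_top at_top" and "s_0 f lam < a"
  shows "0 < a" and "lam < f a / a"
proof -
  let ?S = "{v. 0 < v \<and> f v / v > lam}"
  have "eventually (\<lambda>v. lam < f v / v) at_top"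
    using assms(3) by (simp add: filterlim_at_top_dense)
  then have "eventually (\<lambda>v. v \<in> ?S) at_top"
    using eventually_gt_at_top[of 0] by eventually_elim auto
  then have ne: "?S \<noteq> {}" using eventually_happens[of _ at_top] by fastforce
  obtain v where v: "v \<in> ?S" "v < a"
    using assms(4) cInf_lessD[OF ne] unfolding s_0_def by blast
  then show "0 < a" by simp
  show "lam < f a / a" using v convex_quotient_mono[OF assms(1,2), of v a] by auto
qed

section \<open>Osgood blow-up criterion\<close>

text \<open>
  With \<open>G v\<close> the integral of \<open>1 / f\<close> from \<open>a\<close> to \<open>v\<close>, the differential inequality says that
  \<open>G (F t) - c * t\<close> is nondecreasing, while \<open>G\<close> is bounded by \<open>K\<close>. The inequality is only assumed
  where \<open>F > a\<close>, so it must first be shown that \<open>F\<close> never leaves this region.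
\<close>

lemma osgood_time_bound:
  fixes f F F' :: "real \<Rightarrow> real"
  assumes cont_f: "continuous_on {a..} f" and f_pos: "\<And>v. a \<le> v \<Longrightarrow> 0 < f v"
    and K: "\<And>v. a \<le> v \<Longrightarrow> integral {a..v} (\<lambda>v. 1 / f v) \<le> K"
    and "0 < \<tau>" and "0 \<le> c"
    and cont_F: "continuous_on {0..\<tau>} F" and start: "a < F 0"
    and deriv: "\<And>t. 0 < t \<Longrightarrow> t < \<tau> \<Longrightarrow> (F has_real_derivative F' t) (at t)"
    and ineq: "\<And>t. 0 < t \<Longrightarrow> t < \<tau> \<Longrightarrow> a < F t \<Longrightarrow> c * f (F t) \<le> F' t"
  shows "c * \<tau> \<le> K"
proof -
  have above: "a < F t" if "t \<in> {0..\<tau>}" for t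
  proof (rule ccontr)
    assume "\<not> a < F t"
    define S where "S = {0..\<tau>} \<inter> F -` {..a}"
    have S: "closed S" "S \<noteq> {}" "bdd_below S"
      using continuous_closed_preimage[OF cont_F closed_atLeastAtMost closed_atMost] that
        \<open>\<not> a < F t\<close> by (auto simp: S_def intro: bdd_below_mono[of "{0..\<tau>}"])
    \<comment> \<open>Before the first time \<open>\<sigma>\<close> with \<open>F \<sigma> \<le> a\<close> the function \<open>F\<close> is nondecreasing, hence
      \<open>F \<sigma> \<ge> F 0 > a\<close>.\<close>
    define \<sigma> where "\<sigma> = Inf S"
    have "\<sigma> \<in> S" using closed_contains_Inf[OF S(2,3,1)] by (simp add: \<sigma>_def)
    then have \<sigma>: "0 \<le> \<sigma>" "\<sigma> \<le> \<tau>" "F \<sigma> \<le> a" by (auto simp: S_def)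
    have before: "a < F t" if "0 < t" "t < \<sigma>" for t
      using that \<sigma> cInf_lower[OF _ S(3), of t] by (force simp: S_def \<sigma>_def)
    have "F 0 \<le> F \<sigma>"
    proof (rule DERIV_nonneg_imp_increasing_open[OF \<sigma>(1)])
      fix t assume t: "0 < t" "t < \<sigma>"
      then have "0 \<le> c * f (F t)" using before f_pos \<open>0 \<le> c\<close> by (simp add: less_imp_le)
      also have "\<dots> \<le> F' t" using t \<sigma> before by (intro ineq) auto
      finally show "\<exists>y. (F has_real_derivative y) (at t) \<and> 0 \<le> y"
        using deriv t \<sigma> by (meson less_le_trans)
    qed (use cont_F \<sigma> in \<open>auto intro: continuous_on_subset\<close>)
    then show False using start \<sigma> by simp
  qed
  define g where "g v = 1 / f v" for v
  define G where "G v = integral {a..v} g" for v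
  \<comment> \<open>The interval \<open>{a..b + 1}\<close> contains every value of \<open>F\<close> in its interior, so that \<open>G\<close> has a
    two-sided derivative there.\<close>
  obtain b where b: "\<And>t. t \<in> {0..\<tau>} \<Longrightarrow> F t \<le> b"
    using continuous_attains_sup[OF compact_Icc _ cont_F] \<open>0 < \<tau>\<close> by fastforce
  have cont_g: "continuous_on {a..b + 1} g"
    unfolding g_def using f_pos
    by (intro continuous_intros continuous_on_subset[OF cont_f]) (force simp: less_le)+
  have cont_G: "continuous_on {a..b + 1} G"
    unfolding G_def by (intro indefinite_integral_continuous_1 integrable_continuous_real cont_g)
  have G_deriv: "(G has_real_derivative g v) (at v)" if "a < v" "v \<le> b" for v
    using integral_has_real_derivative[OF cont_g, of v] that at_within_Icc_at[of a v "b + 1"]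
    unfolding G_def by simp
  have "G (F 0) - c * 0 \<le> G (F \<tau>) - c * \<tau>"
  proof (rule DERIV_nonneg_imp_increasing_open[of 0 \<tau>])
    fix t assume t: "0 < t" "t < \<tau>"
    have "a < F t" "F t \<le> b" using t above b by auto
    then have "((\<lambda>t. G (F t) - c * t) has_real_derivative g (F t) * F' t - c * 1) (at t)"
      using t by (intro DERIV_diff DERIV_chain2[OF G_deriv deriv] DERIV_cmult DERIV_ident)
    moreover have "c \<le> g (F t) * F' t"
      using ineq[OF t \<open>a < F t\<close>] f_pos[of "F t"] \<open>a < F t\<close> by (simp add: g_def field_simps)
    ultimately show "\<exists>y. ((\<lambda>t. G (F t) - c * t) has_real_derivative y) (at t) \<and> 0 \<le> y"
      by force
  next
    have "F ` {0..\<tau>} \<subseteq> {a..b + 1}" using above b by force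
    then show "continuous_on {0..\<tau>} (\<lambda>t. G (F t) - c * t)"
      by (intro continuous_intros continuous_on_compose2[OF cont_G cont_F])
  qed (use \<open>0 < \<tau>\<close> in simp)
  moreover have "0 \<le> G (F 0)"
    unfolding G_def using f_pos above[of 0] b[of 0] \<open>0 < \<tau>\<close>
    by (intro integral_nonneg integrable_continuous_real continuous_on_subset[OF cont_g])
      (auto simp: g_def less_imp_le)
  moreover have "G (F \<tau>) \<le> K"
    using K[of "F \<tau>"] above[of \<tau>] \<open>0 < \<tau>\<close> by (simp add: G_def g_def[abs_def])
  ultimately show ?thesis by simp
qed

text \<open>
  Integrability is assumed from \<open>1\<close> on, but the integrals start at \<open>a\<close>, which may be smaller;
  on the gap \<open>{a..1}\<close> the integrand is continuous.
\<close>

lemma reciprocal_integrals_bounded: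
  fixes f :: "real \<Rightarrow> real"
  assumes cont: "continuous_on {0<..} f" and pos: "\<forall>v>0. 0 < f v"
    and int: "set_integrable lborel {1..} (\<lambda>v. 1 / f v)" and "0 < a"
  obtains K where "\<And>v. integral {a..v} (\<lambda>v. 1 / f v) \<le> K"
proof -
  let ?g = "\<lambda>v. 1 / f v"
  let ?I = "{min a 1..1} \<union> {1..}"
  have g: "?g integrable_on {x..y}" if "0 < x" for x y
    using that pos by (intro integrable_continuous_real continuous_intros
        continuous_on_subset[OF cont]) (force simp: less_le)+
  have "{min a 1..1} \<inter> {1..} = {1}" by auto
  then have "?g integrable_on ?I"
    using g[of "min a 1" 1] set_borel_integral_eq_integral(1)[OF int] \<open>0 < a\<close>
    by (intro integrable_Un) (auto simp: negligible_sing)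
  then have "integral {a..v} ?g \<le> integral ?I ?g" for v
    using g[OF \<open>0 < a\<close>] pos \<open>0 < a\<close>
    by (intro integral_subset_le) (auto simp: less_imp_le)
  then show thesis by (rule that)
qed

section \<open>Blow-up\<close>

text \<open>
  A finite partial sum already exceeds \<open>a\<close>, and on a finite set the cutoff tends to \<open>1\<close> uniformly.
\<close>

lemma cutoff_mass_eventually_gt:
  fixes p :: "'a \<Rightarrow> real"
  assumes p: "\<And>x. 0 \<le> p x" and "0 \<le> a" and a: "a < (\<Sum>\<^sub>\<infinity>x. p x)"
    and fin: "\<And>R. 0 < R \<Longrightarrow> finite (pm_ball d x0 R)"
  shows "\<forall>\<^sub>F R in at_top. a < (\<Sum>x\<in>pm_ball d x0 R. cutoff d x0 R x * p x)"
proof -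
  have "p summable_on UNIV"
    using a \<open>0 \<le> a\<close> infsum_not_exists[of p UNIV] by fastforce
  then have "(sum p \<longlongrightarrow> infsum p UNIV) (finite_subsets_at_top UNIV)"
    by (rule infsum_tendsto)
  then have "\<forall>\<^sub>F S in finite_subsets_at_top UNIV. a < sum p S"
    using a by (rule order_tendstoD)
  then obtain S where S: "finite S" "a < sum p S"
    by (auto simp: eventually_finite_subsets_at_top)
  have "((\<lambda>R. \<Sum>x\<in>S. cutoff d x0 R x * p x) \<longlongrightarrow> (\<Sum>x\<in>S. 1 * p x)) at_top"
    by (intro tendsto_intros cutoff_tendsto_1)
  then have "\<forall>\<^sub>F R in at_top. a < (\<Sum>x\<in>S. cutoff d x0 R x * p x)"
    by (rule order_tendstoD) (simp add: S)
  then show ?thesis using eventually_gt_at_top[of 0]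
  proof eventually_elim
    case (elim R)
    have "(\<Sum>x\<in>S. cutoff d x0 R x * p x) = (\<Sum>x\<in>S \<inter> pm_ball d x0 R. cutoff d x0 R x * p x)"
      using S elim by (intro sum.mono_neutral_right) (auto simp: cutoff_outside)
    also have "\<dots> \<le> (\<Sum>x\<in>pm_ball d x0 R. cutoff d x0 R x * p x)"
      using fin[of R] elim p by (intro sum_mono2) (auto simp: cutoff_nonneg)
    finally show ?case using elim by simp
  qed
qed

theorem theorem4p2:
  fixes \<mu> :: "'a \<Rightarrow> real" and \<omega> d :: "'a \<Rightarrow> 'a \<Rightarrow> real" and x0 :: 'a
    and f :: "real \<Rightarrow> real" and u0 :: "'a \<Rightarrow> real" and u :: "'a \<Rightarrow> real \<Rightarrow> real"
    and T :: ereal and \<phi> :: "'a \<Rightarrow> real" and lam :: real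
  assumes "weighted_graph \<mu> \<omega>" and "connected_graph \<omega>"
    and "pseudo_metric d" and "property_PM \<mu> \<omega> d"
    and "\<forall>v\<ge>0. f v \<ge> 0"
    and "locally_lipschitz_on {0..} f" and "convex_on {0..} f"
    and "f 0 = 0" and "\<forall>v>0. f v > 0"
    and "set_integrable lborel {1..} (\<lambda>v. 1 / f v)"
    and "filterlim (\<lambda>v. f v / v) at_top at_top"
    and "\<forall>x. u0 x \<ge> 0" and "in_ell_inf u0" and "\<exists>x. u0 x \<noteq> 0"
    and "maximal_solution \<mu> \<omega> f u0 u T"
    and "property_BG \<mu> \<omega> d x0 \<phi> lam"
    and "\<forall>t0 T'. 0 < t0 \<and> t0 < T' \<and> ereal T' < T \<longrightarrow>
           in_ell_1 \<mu> (\<lambda>x. \<phi> x * (SUP t\<in>{t0<..<T'}. \<bar>deriv (u x) t\<bar>))"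
    and "(\<Sum>\<^sub>\<infinity>x. u0 x * \<phi> x * \<mu> x) > s_0 f lam"
  shows "blows_up_in_finite_time u T"
proof -
  note graph = assms(1) and metric = assms(3) and PM = assms(4) and convex = assms(7)
    and f0 = assms(8) and f_pos = assms(9)
  have mu: "\<And>x. 0 < \<mu> x" using graph by (auto simp: weighted_graph_def)
  have balls: "\<And>x r. 0 < r \<Longrightarrow> finite (pm_ball d x r)" using PM by (auto simp: property_PM_def)
  have phi: "\<And>x. 0 < \<phi> x" "((\<lambda>x. \<phi> x * \<mu> x) has_sum 1) UNIV" "0 < lam"
      "\<And>x. 0 \<le> laplacian \<mu> \<omega> \<phi> x + lam * \<phi> x"
    using assms(16) by (auto simp: property_BG_def)
  obtain C\<^sub>0 where C0: "0 < C\<^sub>0" "\<And>x. (\<lambda>y. \<omega> x y * d x y) summable_on UNIV"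
      "\<And>x. 1 / \<mu> x * (\<Sum>\<^sub>\<infinity>y. \<omega> x y * d x y) \<le> C\<^sub>0"
    using PM unfolding property_PM_def by blast
  have sol: "solution \<mu> \<omega> f u0 u T" using assms(15) by (simp add: maximal_solution_def)
  have "T \<noteq> \<infinity>"
  proof
    assume T: "T = \<infinity>"
    have C1: "\<And>x. u x C1_differentiable_on {t. 0 < t}"
      and cont: "\<And>x. continuous_on {t. 0 \<le> t} (u x)"
      and bdd: "\<And>T'. 0 < T' \<Longrightarrow> bounded ((\<lambda>(x, t). u x t) ` (UNIV \<times> {0..T'}))"
      and nonneg: "\<And>x t. 0 < t \<Longrightarrow> 0 \<le> u x t"
      and init: "\<And>x. u x 0 = u0 x"
      using sol unfolding solution_def T by simp_all
    have eq: "deriv (u x) t = laplacian \<mu> \<omega> (\<lambda>y. u y t) x + f (u x t)" if "0 < t" for x t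
    proof -
      have "deriv (u x) t - laplacian \<mu> \<omega> (\<lambda>y. u y t) x = f (u x t)"
        using sol that unfolding solution_def T by simp
      then show ?thesis by simp
    qed
    obtain a where a: "s_0 f lam < a" "a < (\<Sum>\<^sub>\<infinity>x. u0 x * \<phi> x * \<mu> x)"
      using assms(18) dense by blast
    have a_pos: "0 < a" and a_lam: "lam < f a / a"
      using above_s_0[OF convex f0 assms(11) a(1)] by auto
    have fa: "0 < f a" using f_pos a_pos by simp
    \<comment> \<open>For \<open>v \<ge> a\<close> one has \<open>lam * v / f v \<le> lam * a / f a < 1\<close>, so the linear loss takes away
      at most the fixed fraction \<open>1 - c\<close> of the reaction.\<close>
    define c where "c = 1 - lam * a / f a"
    have c: "0 < c" using a_lam a_pos fa by (simp add: c_def field_simps)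
    have reaction: "c * f v \<le> f v - lam * v" "f a \<le> f v" if "a \<le> v" for v
    proof -
      have q: "f a / a \<le> f v / v" using convex_quotient_mono[OF convex f0 a_pos that] .
      have fv: "0 < f v" using f_pos a_pos that by simp
      have "lam * v \<le> (lam * a / f a) * f v"
        using mult_left_mono[OF q, of "lam * a * v / f a"] a_pos that fa phi(3)
        by (simp add: field_simps)
      then show "c * f v \<le> f v - lam * v" by (simp add: c_def algebra_simps)
      have "f a * a \<le> f a * v" using that fa by simp
      also have "\<dots> \<le> f v * a" using q a_pos that by (simp add: field_simps)
      finally show "f a \<le> f v" using a_pos by simp
    qed
    have cont_f: "continuous_on {0<..} f"
      by (intro convex_on_continuous convex_on_subset[OF convex]) auto
    obtain K where K: "\<And>v. integral {a..v} (\<lambda>v. 1 / f v) \<le> K"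
      using reciprocal_integrals_bounded[OF cont_f f_pos assms(10) a_pos] by blast
    \<comment> \<open>The differential inequality will hold with constant \<open>c / 2\<close>, which limits the length of the
      time interval to \<open>2 * K / c\<close>; the chosen \<open>\<tau>\<close> is longer.\<close>
    define \<tau> where "\<tau> = 2 * (\<bar>K\<bar> + 1) / c"
    have tau: "0 < \<tau>" using c by (simp add: \<tau>_def)
    obtain M where "\<forall>z\<in>(\<lambda>(x, t). u x t) ` (UNIV \<times> {0..\<tau>}). norm z \<le> M"
      using bdd[OF tau] unfolding bounded_iff by blast
    then have M: "\<bar>u x t\<bar> \<le> M" if "t \<in> {0..\<tau>}" for x t
      using that by auto
    have "((\<lambda>R. M * C\<^sub>0 / R) \<longlongrightarrow> 0) at_top"
      by (intro tendsto_divide_0[OF tendsto_const] filterlim_at_top_imp_at_infinity filterlim_ident)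
    then have "\<forall>\<^sub>F R in at_top. M * C\<^sub>0 / R < c / 2 * f a"
      using c fa by (intro order_tendstoD) auto
    moreover have "\<forall>\<^sub>F R in at_top.
        a < (\<Sum>x\<in>pm_ball d x0 R. cutoff d x0 R x * (u0 x * \<phi> x * \<mu> x))"
      using assms(12) phi(1) mu a_pos a(2) balls
      by (intro cutoff_mass_eventually_gt) (auto simp: less_imp_le)
    ultimately have "\<forall>\<^sub>F R in at_top. 0 < R \<and> M * C\<^sub>0 / R < c / 2 * f a \<and>
        a < (\<Sum>x\<in>pm_ball d x0 R. cutoff d x0 R x * (u0 x * \<phi> x * \<mu> x))"
      using eventually_gt_at_top[of 0] by eventually_elim auto
    then obtain R where R: "0 < R" "M * C\<^sub>0 / R < c / 2 * f a"
        "a < (\<Sum>x\<in>pm_ball d x0 R. cutoff d x0 R x * (u0 x * \<phi> x * \<mu> x))"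
      using eventually_happens'[OF trivial_limit_at_top_linorder] by blast
    define B where "B = pm_ball d x0 R"
    define w where "w x = cutoff d x0 R x * \<phi> x * \<mu> x" for x
    define F where "F t = (\<Sum>x\<in>B. w x * u x t)" for t
    define F' where "F' t = (\<Sum>x\<in>B. w x * deriv (u x) t)" for t
    have finB: "finite B" using balls R by (simp add: B_def)
    have w: "0 \<le> w x" for x
      using phi(1) mu by (simp add: w_def cutoff_nonneg less_imp_le)
    have w_mass: "(\<Sum>x\<in>B. w x) \<le> 1"
    proof -
      have "(\<Sum>x\<in>B. w x) \<le> (\<Sum>x\<in>B. 1 * (\<phi> x * \<mu> x))"
        unfolding w_def mult.assoc using phi(1) mu cutoff_le_1[OF metric R(1)]
        by (intro sum_mono mult_right_mono) (auto simp: less_imp_le)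
      also have "\<dots> \<le> (\<Sum>\<^sub>\<infinity>x. \<phi> x * \<mu> x)"
        using phi mu finB has_sum_imp_summable[OF phi(2)]
        by (simp add: finite_sum_le_infsum less_imp_le)
      finally show ?thesis using infsumI[OF phi(2)] by simp
    qed
    have "c / 2 * \<tau> \<le> K"
    proof (rule osgood_time_bound[where a = a and f = f and F = F and F' = F'])
      show "continuous_on {a..} f"
        using cont_f a_pos by (auto intro: continuous_on_subset)
      show "continuous_on {0..\<tau>} F"
        unfolding F_def by (intro continuous_intros continuous_on_subset[OF cont]) auto
      show "a < F 0" using R(3) by (simp add: F_def w_def B_def init mult_ac)
    next
      fix t assume t: "0 < t" "t < \<tau>"
      have "(u x has_real_derivative deriv (u x) t) (at t)" for x
        using C1[of x] t by (simp add: C1_differentiable_on_eq DERIV_deriv_iff_real_differentiable)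
      then show "(F has_real_derivative F' t) (at t)"
        unfolding F_def F'_def by (intro DERIV_sum DERIV_cmult)
      assume aF: "a < F t"
      have "F' t = (\<Sum>x\<in>B. w x * laplacian \<mu> \<omega> (\<lambda>y. u y t) x) + (\<Sum>x\<in>B. w x * f (u x t))"
        using t by (simp add: F'_def eq algebra_simps sum.distrib)
      moreover have "- lam * F t - M * C\<^sub>0 / R \<le> (\<Sum>x\<in>B. w x * laplacian \<mu> \<omega> (\<lambda>y. u y t) x)"
        unfolding F_def w_def B_def
      proof (rule cutoff_laplacian_lower_bound[OF graph metric PM C0(2,3) phi(1,2,4) _ _ R(1)])
        show "0 \<le> u x t" for x using nonneg[OF t(1)] .
        show "u x t \<le> M" for x using M[of t x] t by simp
      qed
      moreover have "f (F t) \<le> (\<Sum>x\<in>B. w x * f (u x t))"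
        unfolding F_def using w w_mass nonneg[OF t(1)]
        by (intro jensen_subprobability[OF convex f0 finB]) auto
      \<comment> \<open>One half of \<open>c * f (F t)\<close> absorbs the error \<open>M * C\<^sub>0 / R < c / 2 * f a\<close>.\<close>
      moreover have "c / 2 * f a \<le> c / 2 * f (F t)"
        using reaction(2)[of "F t"] aF c by simp
      ultimately show "c / 2 * f (F t) \<le> F' t"
        using reaction(1)[of "F t"] aF R(2) by simp
    qed (use f_pos a_pos K tau c in auto)
    then show False using c by (simp add: \<tau>_def)
  qed
  then have "T < \<infinity>" "sup_norm_diverges u T"
    using assms(15) by (auto simp: maximal_solution_def global_in_time_def)
  moreover have "in_ell_inf (\<lambda>x. u x t)" if "0 < t" "ereal t < T" for t
  proof -
    have "bounded ((\<lambda>(x, t). u x t) ` (UNIV \<times> {0..t}))"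
      using sol that by (simp add: solution_def)
    then show ?thesis
      unfolding in_ell_inf_def by (rule bounded_subset) (use that in force)
  qed
  ultimately show ?thesis
    using sol by (auto simp: blows_up_in_finite_time_def solution_def)
qed

end
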